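(* Every paracompact almost Scheepers space is Scheepers.
   Context: $\mathbb{N}$ is the set of positive integers. Paracompact spaces are Hausdorff by convention (Engelking's terminology). A topological space $X$ is almost Scheepers if for every sequence $(\mathcal{U}_n)_{n\in\mathbb{N}}$ of open covers of $X$ there are finite subsets $\mathcal{V}_n\subseteq\mathcal{U}_n$ ($n\in\mathbb{N}$) such that every finite set $F\subseteq X$ is contained in $\overline{\bigcup\mathcal{V}_n}$ for some $n$. $X$ is Scheepers if for every sequence $(\mathcal{U}_n)$ of open covers of $X$ there are finite subsets $\mathcal{V}_n\subseteq\mathcal{U}_n$ such that every finite set $F\subseteq X$ is contained in $\bigcup\mathcal{V}_n$ for some $n$. *)

theory Defs
  imports "HOL-Analysis.Analysis"
begin

definition open_cover_of :: "'a topology \<Rightarrow> 'a set set \<Rightarrow> bool" where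
  "open_cover_of X \<U> \<longleftrightarrow> (\<forall>U\<in>\<U>. openin X U) \<and> \<Union>\<U> = topspace X"

(* Engelking's convention: paracompact spaces are Hausdorff. *)
definition paracompact_space :: "'a topology \<Rightarrow> bool" where
  "paracompact_space X \<longleftrightarrow>
     Hausdorff_space X \<and>
     (\<forall>\<U>. open_cover_of X \<U> \<longrightarrow>
        (\<exists>\<V>. open_cover_of X \<V> \<and> (\<forall>V\<in>\<V>. \<exists>U\<in>\<U>. V \<subseteq> U) \<and> locally_finite_in X \<V>))"

(* Sequences of covers are indexed by nat, i.e. from 0; for these two properties
   this is only a relabelling of the index set of positive integers. *)

definition almost_Scheepers_space :: "'a topology \<Rightarrow> bool" where
  "almost_Scheepers_space X \<longleftrightarrow>
     (\<forall>\<U> :: nat \<Rightarrow> 'a set set. (\<forall>n. open_cover_of X (\<U> n)) \<longrightarrow>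
        (\<exists>\<V> :: nat \<Rightarrow> 'a set set. (\<forall>n. finite (\<V> n) \<and> \<V> n \<subseteq> \<U> n) \<and>
           (\<forall>F. finite F \<and> F \<subseteq> topspace X \<longrightarrow> (\<exists>n. F \<subseteq> X closure_of \<Union>(\<V> n)))))"

definition Scheepers_space :: "'a topology \<Rightarrow> bool" where
  "Scheepers_space X \<longleftrightarrow>
     (\<forall>\<U> :: nat \<Rightarrow> 'a set set. (\<forall>n. open_cover_of X (\<U> n)) \<longrightarrow>
        (\<exists>\<V> :: nat \<Rightarrow> 'a set set. (\<forall>n. finite (\<V> n) \<and> \<V> n \<subseteq> \<U> n) \<and>
           (\<forall>F. finite F \<and> F \<subseteq> topspace X \<longrightarrow> (\<exists>n. F \<subseteq> \<Union>(\<V> n)))))"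

end

theory Submission
  imports Defs
begin

text \<open>
  A paracompact Hausdorff space is regular, so the open sets whose closure lies inside some member
  of a given open cover again form an open cover. Apply the almost Scheepers property to these
  shrunk covers: since finite unions commute with closures, the closure of the union of finitely
  many shrunk sets is covered by finitely many members of the original cover.
\<close>

text \<open>Hausdorffness separates \<open>a\<close> from each single point of \<open>C\<close>. A
  locally finite refinement merges these separations into one for all of \<open>C\<close>, because
  the union of a locally finite family of closures is closed.\<close>

lemma paracompact_imp_regular_space:
  assumes "paracompact_space X"
  shows "regular_space X"
  unfolding regular_space_def
proof (intro allI impI)
  fix C a
  assume "closedin X C \<and> a \<in> topspace X - C"
  then have C: "closedin X C" and a: "a \<in> topspace X" "a \<notin> C" by auto
  \<comment> \<open>The complement of \<open>C\<close> is there to cover the points off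
    \<open>C\<close>. A refining set that meets \<open>C\<close> cannot lie in it, so it must lie in
    an open set whose closure misses \<open>a\<close>.\<close>
  define \<U> where "\<U> = insert (topspace X - C) {V. openin X V \<and> a \<notin> X closure_of V}"
  have "\<exists>V\<in>\<U>. y \<in> V" if y: "y \<in> topspace X" for y
  proof (cases "y \<in> C")
    case True
    then have "y \<noteq> a" using a by auto
    then obtain U V where UV: "openin X U" "openin X V" "y \<in> V" "a \<in> U" "disjnt U V"
      using assms a y unfolding paracompact_space_def Hausdorff_space_def by metis
    then have "a \<notin> X closure_of V"
      by (auto simp: in_closure_of disjnt_iff)
    with UV show ?thesis unfolding \<U>_def by auto
  next
    case False
    with y show ?thesis unfolding \<U>_def by auto
  qed
  moreover have "openin X V" if "V \<in> \<U>" for V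
    using that C unfolding \<U>_def by auto
  ultimately have "open_cover_of X \<U>"
    unfolding open_cover_of_def by (blast dest: openin_subset)
  then obtain \<V> where \<V>: "open_cover_of X \<V>" "\<forall>V\<in>\<V>. \<exists>U\<in>\<U>. V \<subseteq> U" "locally_finite_in X \<V>"
    using assms unfolding paracompact_space_def by blast
  define \<A> where "\<A> = {V \<in> \<V>. V \<inter> C \<noteq> {}}"
  have opn: "\<And>V. V \<in> \<A> \<Longrightarrow> openin X V" and cov: "topspace X = \<Union>\<V>"
    using \<V>(1) unfolding open_cover_of_def \<A>_def by auto
  have C_sub: "C \<subseteq> \<Union>\<A>"
    using cov closedin_subset[OF C] unfolding \<A>_def by blast
  have away: "a \<notin> X closure_of V" if V: "V \<in> \<A>" for V
  proof -
    obtain U where U: "U \<in> \<U>" "V \<subseteq> U"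
      using \<V>(2) V unfolding \<A>_def by blast
    then have "a \<notin> X closure_of U"
      using V unfolding \<U>_def \<A>_def by auto
    then show ?thesis using closure_of_mono[OF U(2)] by blast
  qed
  \<comment> \<open>\<open>?W\<close> will be the neighbourhood of \<open>a\<close>, and
    \<Union>\<A> that of \<open>C\<close>. Taking closures before the complement is what makes
    \<open>?W\<close> open, by local finiteness.\<close>
  let ?W = "topspace X - \<Union>((\<lambda>S. X closure_of S) ` \<A>)"
  have "locally_finite_in X \<A>"
    by (rule locally_finite_in_subset[OF \<V>(3)]) (auto simp: \<A>_def)
  then have "openin X ?W"
    using closedin_Union_locally_finite_closure openin_diff openin_topspace by blast
  moreover have "openin X (\<Union>\<A>)" using opn by blast
  moreover have "a \<in> ?W" using a away by auto
  moreover have "disjnt ?W (\<Union>\<A>)"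
    using closure_of_subset[OF openin_subset[OF opn]] unfolding disjnt_iff by blast
  ultimately show "\<exists>U V. openin X U \<and> openin X V \<and> a \<in> U \<and> C \<subseteq> V \<and> disjnt U V"
    using C_sub by blast
qed

lemma regular_space_closure_refinement:
  assumes "regular_space X" "open_cover_of X \<U>"
  shows "open_cover_of X {W. openin X W \<and> (\<exists>U\<in>\<U>. X closure_of W \<subseteq> U)}"
  unfolding open_cover_of_def
proof (intro conjI ballI equalityI subsetI)
  fix x assume "x \<in> topspace X"
  then obtain U where U: "U \<in> \<U>" "openin X U" "x \<in> U"
    using assms(2) unfolding open_cover_of_def by blast
  \<comment> \<open>Regularity is used in its equivalent form: the closed neighbourhoods of each
    point form a neighbourhood base.\<close>
  then obtain W C where "openin X W" "closedin X C" "x \<in> W" "W \<subseteq> C" "C \<subseteq> U"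
    using assms(1) unfolding neighbourhood_base_of_closedin[symmetric] neighbourhood_base_of
    by meson
  moreover from this have "X closure_of W \<subseteq> U"
    using closure_of_minimal by blast
  ultimately show "x \<in> \<Union>{W. openin X W \<and> (\<exists>U\<in>\<U>. X closure_of W \<subseteq> U)}"
    using U by blast
qed (use openin_subset in auto)

lemma regular_almost_Scheepers_imp_Scheepers:
  assumes reg: "regular_space X" and almost: "almost_Scheepers_space X"
  shows "Scheepers_space X"
  unfolding Scheepers_space_def
proof (intro allI impI)
  fix \<U> :: "nat \<Rightarrow> 'a set set"
  assume cov: "\<forall>n. open_cover_of X (\<U> n)"
  define \<W> where "\<W> = (\<lambda>n. {W. openin X W \<and> (\<exists>U\<in>\<U> n. X closure_of W \<subseteq> U)})"
  have "\<forall>n. open_cover_of X (\<W> n)"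
    using regular_space_closure_refinement[OF reg] cov unfolding \<W>_def by blast
  then obtain \<V> where fin: "\<And>n. finite (\<V> n)" and sub: "\<And>n. \<V> n \<subseteq> \<W> n"
    and dense: "\<And>F. finite F \<Longrightarrow> F \<subseteq> topspace X \<Longrightarrow> \<exists>n. F \<subseteq> X closure_of \<Union>(\<V> n)"
    using almost unfolding almost_Scheepers_space_def by metis
  have "\<forall>n. \<forall>W\<in>\<V> n. \<exists>U. U \<in> \<U> n \<and> X closure_of W \<subseteq> U"
    using sub unfolding \<W>_def by blast
  then obtain u where u: "\<And>n W. W \<in> \<V> n \<Longrightarrow> u n W \<in> \<U> n \<and> X closure_of W \<subseteq> u n W"
    by metis
  \<comment> \<open>Finiteness of \<open>\<V> n\<close> matters here: the closure of the union is
    the union of the closures. The index \<open>n\<close> that serves a finite set \<open>F\<close>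
    for the closures then serves it for the new selections too.\<close>
  have closure_sub: "X closure_of \<Union>(\<V> n) \<subseteq> \<Union>(u n ` \<V> n)" for n
    using u[of _ n] by (subst closure_of_Union[OF fin]) blast
  show "\<exists>\<V>. (\<forall>n. finite (\<V> n) \<and> \<V> n \<subseteq> \<U> n) \<and>
      (\<forall>F. finite F \<and> F \<subseteq> topspace X \<longrightarrow> (\<exists>n. F \<subseteq> \<Union>(\<V> n)))"
  proof (intro exI[of _ "\<lambda>n. u n ` \<V> n"] conjI allI impI)
    fix F assume "finite F \<and> F \<subseteq> topspace X"
    then show "\<exists>n. F \<subseteq> \<Union>(u n ` \<V> n)"
      using dense closure_sub by (meson order_trans)
  qed (use u fin in auto)
qed

theorem theorem3p2:
  fixes X :: "'a topology"
  assumes "paracompact_space X"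
    and "almost_Scheepers_space X"
  shows "Scheepers_space X"
  using assms paracompact_imp_regular_space regular_almost_Scheepers_imp_Scheepers by blast

end
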